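(* Fix an orthant $\mathcal O^{(r)}$ with sign matrix $J^{(r)}=\mathrm{diag}(j^{(r)}_{11},\dots,j^{(r)}_{nn})$, $j^{(r)}_{ii}\in\{-1,1\}$, and consider the dynamics $X(t+1)=A^{(r)}X(t)+b^{(r)}(X(t))$, $t=0,1,2,\dots$, with $X(0)\in\mathbb R^n_+$. Suppose that $$(Dp)_i\le \big((\hat C^{-1}-C\hat C^{-1})\underline v\big)_i+\beta\quad\text{for all } i\in\mathcal N^{(r)},$$ $$(Dp)_i\ge \big((\hat C^{-1}-C\hat C^{-1})\underline v\big)_i\quad\text{for all } i\in\mathcal P^{(r)},$$ that $c_{il}=0$ for all $i,l\in N$ with $j^{(r)}_{ii}\ne j^{(r)}_{ll}$, and that for every $i\in N$ $$0\le \sum_{l=1,\,l\ne i}^n \hat c_{ii}\,c_{il}\,\frac{1}{\hat c_{ll}}<1.$$ Then $X(t)$ converges, as $t\to\infty$, to the following equilibrium point, which is the unique equilibrium point in the positive orthant $\mathbb R^n_+$: $$X^*=(I-J^{(r)}\hat C C\hat C^{-1}J^{(r)})^{-1}\Big[J^{(r)}\Big((\hat C C\hat C^{-1}-I)\underline v+\hat C\big(Dp-U(J^{(r)}X^* )-\mathbf 1\tfrac{\beta}{2}\big)\Big)\Big].$$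
   Context: Setting: $N=\{1,\dots,n\}$; $C=[c_{il}]\in\mathbb R^{n\times n}$ with $c_{il}\in[0,1]$, $c_{ii}=0$; $\hat c_{ii}:=1-\sum_{j\ne i}c_{ji}$, assumed $>0$ for every $i$; $\hat C:=\mathrm{diag}(\hat c_{11},\dots,\hat c_{nn})$; $D\in\mathbb R^{n\times m}$, $p\in\mathbb R^m$, $\underline v\in\mathbb R^n$ are given; $\beta\ge 0$ is a real number; $\mathbf 1$ is the all-ones vector; $I$ is the identity matrix. Vector inequalities are componentwise. The $2^n$ orthants of $\mathbb R^n$ are indexed by $r$. The diagonal matrix $J^{(r)}$ has $j^{(r)}_{ii}=-1$ if $x_i<0$ and $j^{(r)}_{ii}=1$ if $x_i\ge 0$, for a generic $x$ in the $r$-th orthant; the orthant is $\mathcal O^{(r)}:=\{x\in\mathbb R^n: J^{(r)}x\ge 0\}$. Put $\mathcal P^{(r)}:=\{i\in N: j^{(r)}_{ii}=1\}$ and $\mathcal N^{(r)}:=\{i\in N: j^{(r)}_{ii}=-1\}$. Failure term: $U(x)=[U_i(x)]_{i\in N}$ with $U_i(x)=\beta/2$ if $x_i<0$ and $U_i(x)=-\beta/2$ if $x_i\ge 0$. $A^{(r)}:=J^{(r)}\hat C C\hat C^{-1}J^{(r)}$ and, for $X\in\mathbb R^n$, $$b^{(r)}(X):=J^{(r)}\Big[(\hat C C\hat C^{-1}-I)\underline v+\hat C\big(Dp-U(J^{(r)}X)-\mathbf 1\tfrac{\beta}{2}\big)\Big].$$ An equilibrium point is an $X^*$ with $X^*=A^{(r)}X^*+b^{(r)}(X^*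 )$.
   Formalization: U is changed at coordinates x_i = 0 with i in N^(r): it equals β/2 there (its value inside the fixed orthant), not -β/2. With the literal U uniqueness fails: n=1, C=0, J=-1, Dp=0, v=0, β=1 has equilibria X=0 and X=1. *)

theory Defs
  imports "HOL-Analysis.Analysis"
begin

definition Chat :: "real^'n^'n \<Rightarrow> real^'n^'n" where
  "Chat C = (\<chi> i l. if i = l then 1 - (\<Sum>j\<in>UNIV - {i}. C $ j $ i) else 0)"

definition sign_matrix :: "real^'n^'n \<Rightarrow> bool" where
  "sign_matrix J \<longleftrightarrow> (\<forall>i. J $ i $ i \<in> {-1, 1}) \<and> (\<forall>i l. i \<noteq> l \<longrightarrow> J $ i $ l = 0)"

definition orthant :: "real^'n^'n \<Rightarrow> (real^'n) set" where
  "orthant J = {x. 0 \<le> J *v x}"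

definition positive_orthant :: "(real^'n) set" where
  "positive_orthant = orthant (mat 1)"

definition pos_indices :: "real^'n^'n \<Rightarrow> 'n set" where
  "pos_indices J = {i. J $ i $ i = 1}"

definition neg_indices :: "real^'n^'n \<Rightarrow> 'n set" where
  "neg_indices J = {i. J $ i $ i = -1}"

definition failure :: "real \<Rightarrow> real^'n \<Rightarrow> real^'n" where
  "failure \<beta> x = (\<chi> i. if x $ i < 0 then \<beta> / 2 else - (\<beta> / 2))"

text \<open>
  The closed orthants overlap on the coordinate hyperplanes, where \<^const>\<open>failure\<close> jumps. The
  dynamics of a fixed orthant with sign matrix \<open>J\<close> uses the version of \<^const>\<open>failure\<close> below, in
  which a coordinate \<open>x\<^sub>i = 0\<close> takes the value that the failure term has inside that orthant. The
  two versions differ only where \<open>x\<^sub>i = 0\<close> and \<open>J\<^sub>i\<^sub>i = -1\<close>. With \<^const>\<open>failure\<close> itself,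
  uniqueness of the equilibrium in the closed positive orthant is false: for \<open>n = 1\<close>, \<open>C = 0\<close>,
  \<open>J = -1\<close>, \<open>D p = 0\<close>, \<open>v = 0\<close>, \<open>\<beta> = 1\<close>, both \<open>X = 0\<close> and \<open>X = 1\<close> are equilibria.
\<close>

definition failure_on :: "real^'n^'n \<Rightarrow> real \<Rightarrow> real^'n \<Rightarrow> real^'n" where
  "failure_on J \<beta> x =
     (\<chi> i. if x $ i < 0 \<or> (x $ i = 0 \<and> J $ i $ i = -1) then \<beta> / 2 else - (\<beta> / 2))"

lemma failure_on_eq_failure:
  assumes "\<And>i. i \<in> neg_indices J \<Longrightarrow> x $ i \<noteq> 0"
  shows "failure_on J \<beta> x = failure \<beta> x"
  using assms by (auto simp: failure_on_def failure_def neg_indices_def vec_eq_iff)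

lemma sign_matrix_mult_nth:
  assumes "sign_matrix J"
  shows "(J *v x) $ i = J $ i $ i * x $ i"
proof -
  have *: "J $ i $ l * x $ l = (if l = i then J $ i $ i * x $ i else 0)" for l
    using assms by (auto simp: sign_matrix_def)
  have "(\<Sum>l\<in>UNIV. J $ i $ l * x $ l) = (\<Sum>l\<in>UNIV. if l = i then J $ i $ i * x $ i else 0)"
    by (rule sum.cong[OF refl *])
  then show ?thesis by (simp add: matrix_vector_mult_def)
qed

lemma failure_on_eq_failure_generic:
  assumes J: "sign_matrix J" and x: "x \<in> orthant J"
    and y: "\<And>i. 0 < (J *v y) $ i"
  shows "failure_on J \<beta> x = failure \<beta> y"
proof -
  have "(x $ i < 0 \<or> (x $ i = 0 \<and> J $ i $ i = -1)) \<longleftrightarrow> y $ i < 0" for i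
  proof -
    have "0 \<le> J $ i $ i * x $ i" "0 < J $ i $ i * y $ i"
      using x y[of i] sign_matrix_mult_nth[OF J] by (auto simp: orthant_def less_eq_vec_def)
    moreover have "J $ i $ i = -1 \<or> J $ i $ i = 1"
      using J by (auto simp: sign_matrix_def)
    ultimately show ?thesis by auto
  qed
  then show ?thesis by (simp add: failure_on_def failure_def vec_eq_iff)
qed

definition A_mat :: "real^'n^'n \<Rightarrow> real^'n^'n \<Rightarrow> real^'n^'n" where
  "A_mat C J = J ** Chat C ** C ** matrix_inv (Chat C) ** J"

definition b_vec ::
  "real^'n^'n \<Rightarrow> real^'m^'n \<Rightarrow> real^'m \<Rightarrow> real^'n \<Rightarrow> real \<Rightarrow> real^'n^'n \<Rightarrow> real^'n \<Rightarrow> real^'n" where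
  "b_vec C D p v \<beta> J X =
     J *v ((Chat C ** C ** matrix_inv (Chat C) - mat 1) *v v
           + Chat C *v (D *v p - failure_on J \<beta> (J *v X) - (\<beta> / 2) *\<^sub>R 1))"

definition equilibrium ::
  "real^'n^'n \<Rightarrow> real^'m^'n \<Rightarrow> real^'m \<Rightarrow> real^'n \<Rightarrow> real \<Rightarrow> real^'n^'n \<Rightarrow> real^'n \<Rightarrow> bool" where
  "equilibrium C D p v \<beta> J X \<longleftrightarrow> X = A_mat C J *v X + b_vec C D p v \<beta> J X"

end

theory Submission
  imports Defs
begin

text \<open>
  On the positive orthant \<open>J X\<close> never leaves the closed orthant of \<open>J\<close>, so the failure term, and with
  it \<open>b\<close>, is constant there; the two bounds on \<open>D p\<close> say precisely that this constant is nonnegative.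
  Entries of \<open>C\<close> linking opposite signs vanish, so \<open>A\<close> is nonnegative as well and the positive orthant
  is invariant. There the dynamics is affine, and \<open>A\<close> contracts the maximum norm because its row sums
  are less than \<open>1\<close>.
\<close>

lemma diagonal_matrix_mult_left_nth:
  fixes M :: "'a::semiring_1^'m^'n"
  assumes "\<And>i l. i \<noteq> l \<Longrightarrow> D $ i $ l = 0"
  shows "(D ** M) $ i $ l = D $ i $ i * M $ i $ l"
proof -
  have *: "D $ i $ k * M $ k $ l = (if k = i then D $ i $ i * M $ i $ l else 0)" for k
    using assms by auto
  show ?thesis unfolding matrix_matrix_mult_def by (simp add: sum.cong[OF refl *])
qed

lemma diagonal_matrix_mult_right_nth:
  fixes M :: "'a::semiring_1^'n^'m"
  assumes "\<And>i l. i \<noteq> l \<Longrightarrow> D $ i $ l = 0"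
  shows "(M ** D) $ i $ l = M $ i $ l * D $ l $ l"
proof -
  have *: "M $ i $ k * D $ k $ l = (if k = l then M $ i $ l * D $ l $ l else 0)" for k
    using assms by auto
  show ?thesis unfolding matrix_matrix_mult_def by (simp add: sum.cong[OF refl *])
qed

lemma diagonal_matrix_vector_mult_nth:
  fixes x :: "'a::semiring_1^'n"
  assumes "\<And>i l. i \<noteq> l \<Longrightarrow> D $ i $ l = 0"
  shows "(D *v x) $ i = D $ i $ i * x $ i"
proof -
  have *: "D $ i $ k * x $ k = (if k = i then D $ i $ i * x $ i else 0)" for k
    using assms by auto
  show ?thesis unfolding matrix_vector_mult_def by (simp add: sum.cong[OF refl *])
qed

lemma matrix_inv_right:
  assumes "invertible A"
  shows "A ** matrix_inv A = mat 1"
  using assms unfolding invertible_def matrix_inv_def by (rule someI2_ex) blast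

lemma matrix_inv_left:
  assumes "invertible A"
  shows "matrix_inv A ** A = mat 1"
  using assms unfolding invertible_def matrix_inv_def by (rule someI2_ex) blast

lemma matrix_inv_unique:
  assumes "A ** B = mat 1" "B ** A = mat 1"
  shows "matrix_inv A = B"
proof -
  have "invertible A" using assms by (auto simp: invertible_def)
  have "matrix_inv A = matrix_inv A ** (A ** B)" by (simp add: assms)
  also have "\<dots> = B"
    using matrix_inv_left[OF \<open>invertible A\<close>] by (simp add: matrix_mul_assoc)
  finally show ?thesis .
qed

text \<open>Supplies the entries of the inverse of \<open>Chat C\<close>, which is diagonal with
  positive diagonal.\<close>

lemma matrix_inv_diagonal:
  fixes D :: "real^'n^'n"
  assumes off: "\<And>i l. i \<noteq> l \<Longrightarrow> D $ i $ l = 0" and nz: "\<And>i. D $ i $ i \<noteq> 0"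
  shows "matrix_inv D = (\<chi> i l. if i = l then 1 / D $ i $ i else 0)"
proof -
  let ?E = "\<chi> i l. if i = l then 1 / D $ i $ i else 0"
  have "D ** ?E = mat 1" "?E ** D = mat 1"
    using nz by (simp_all add: vec_eq_iff diagonal_matrix_mult_left_nth[OF off]
        diagonal_matrix_mult_right_nth[OF off] mat_def off)
  then show ?thesis by (rule matrix_inv_unique)
qed

text \<open>The operator estimate for the maximum norm, stated entrywise so that this norm need not
  be introduced.\<close>

lemma abs_matrix_vector_mult_le:
  fixes A :: "real^'n^'m"
  assumes "\<And>i. (\<Sum>l\<in>UNIV. \<bar>A $ i $ l\<bar>) \<le> q" "\<And>l. \<bar>x $ l\<bar> \<le> M"
  shows "\<bar>(A *v x) $ i\<bar> \<le> q * M"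
proof -
  have "0 \<le> M" by (rule order_trans[OF abs_ge_zero assms(2)])
  have "\<bar>(A *v x) $ i\<bar> \<le> (\<Sum>l\<in>UNIV. \<bar>A $ i $ l * x $ l\<bar>)"
    unfolding matrix_vector_mult_def vec_lambda_beta by (rule sum_abs)
  also have "\<dots> \<le> (\<Sum>l\<in>UNIV. \<bar>A $ i $ l\<bar> * M)"
    by (intro sum_mono) (simp add: abs_mult assms(2) mult_left_mono)
  also have "\<dots> = (\<Sum>l\<in>UNIV. \<bar>A $ i $ l\<bar>) * M" by (simp add: sum_distrib_right)
  also have "\<dots> \<le> q * M"
    by (rule mult_right_mono[OF assms(1) \<open>0 \<le> M\<close>])
  finally show ?thesis .
qed

text \<open>Each step shrinks the maximum norm at least by the factor \<open>q\<close>, the largest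
  absolute row sum, so every entry is dominated by a geometric sequence.\<close>

lemma linear_iteration_tendsto_zero:
  fixes A :: "real^'n^'n" and e :: "nat \<Rightarrow> real^'n"
  assumes rows: "\<And>i. (\<Sum>l\<in>UNIV. \<bar>A $ i $ l\<bar>) < 1" and e: "\<And>t. e (Suc t) = A *v e t"
  shows "e \<longlonglongrightarrow> 0"
proof -
  \<comment> \<open>There are finitely many rows, so the maximum is attained and the strict row
    bounds give one uniform \<open>q < 1\<close>.\<close>
  define q where "q = Max (range (\<lambda>i. \<Sum>l\<in>UNIV. \<bar>A $ i $ l\<bar>))"
  have q_ge: "(\<Sum>l\<in>UNIV. \<bar>A $ i $ l\<bar>) \<le> q" for i
    unfolding q_def by (rule Max_ge) auto
  have "q < 1" unfolding q_def using rows by (subst Max_less_iff) auto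
  have "0 \<le> q" by (rule order_trans[OF _ q_ge]) (simp add: sum_nonneg)
  \<comment> \<open>The Euclidean \<open>norm (e 0)\<close> serves only as a common bound on the
    initial entries. The index stays arbitrary because one step uses the bound for all entries at
    once.\<close>
  have bound: "\<bar>e t $ i\<bar> \<le> q ^ t * norm (e 0)" for t i
  proof (induction t arbitrary: i)
    case 0
    show ?case by (simp add: component_le_norm_cart)
  next
    case (Suc t)
    show ?case
      using abs_matrix_vector_mult_le[where A = A, OF q_ge Suc.IH] by (simp add: e mult.assoc)
  qed
  have "(\<lambda>t. q ^ t * norm (e 0)) \<longlonglongrightarrow> 0"
    using \<open>0 \<le> q\<close> \<open>q < 1\<close> by (auto intro!: tendsto_mult_left_zero LIMSEQ_realpow_zero)
  then have "(\<lambda>t. e t $ i) \<longlonglongrightarrow> 0" for i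
    by (rule Lim_null_comparison[rotated]) (simp add: bound)
  then show ?thesis by (intro vec_tendstoI) simp
qed

text \<open>A kernel vector \<open>x\<close> is fixed by \<open>A\<close>, so the constant sequence
  \<open>x\<close> is an orbit of the iteration; it tends to \<open>0\<close>, hence
  \<open>x = 0\<close>.\<close>

lemma invertible_one_minus_contraction:
  fixes A :: "real^'n^'n"
  assumes "\<And>i. (\<Sum>l\<in>UNIV. \<bar>A $ i $ l\<bar>) < 1"
  shows "invertible (mat 1 - A)"
proof -
  have "x = 0" if "(mat 1 - A) *v x = 0" for x
  proof -
    have "x = A *v x" using that by (simp add: matrix_vector_mult_diff_rdistrib)
    then have "(\<lambda>t::nat. x) \<longlonglongrightarrow> 0"
      by (intro linear_iteration_tendsto_zero[OF assms])
    then show "x = 0" by (simp add: LIMSEQ_const_iff)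
  qed
  then show ?thesis
    by (simp add: invertible_left_inverse matrix_left_invertible_ker)
qed

lemma mem_positive_orthant_iff: "x \<in> positive_orthant \<longleftrightarrow> (\<forall>i. 0 \<le> x $ i)"
  by (simp add: positive_orthant_def orthant_def less_eq_vec_def)

text \<open>The deviation of \<open>X t\<close> from the fixed point \<open>s\<close> obeys the
  homogeneous recursion, so it tends to zero.\<close>

lemma affine_iteration_converges:
  fixes A :: "real^'n^'n" and X :: "nat \<Rightarrow> real^'n"
  assumes rows: "\<And>i. (\<Sum>l\<in>UNIV. \<bar>A $ i $ l\<bar>) < 1" and X: "\<And>t. X (Suc t) = A *v X t + b"
  shows "X \<longlonglongrightarrow> matrix_inv (mat 1 - A) *v b"
proof -
  define s where "s = matrix_inv (mat 1 - A) *v b"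
  have "(mat 1 - A) *v s = b"
    using matrix_inv_right[OF invertible_one_minus_contraction[OF rows]]
    by (simp add: s_def matrix_vector_mul_assoc)
  then have "b = s - A *v s" by (simp add: matrix_vector_mult_diff_rdistrib)
  then have "(\<lambda>t. X t - s) \<longlonglongrightarrow> 0"
    by (intro linear_iteration_tendsto_zero[OF rows])
      (simp add: X matrix_vector_mult_diff_distrib)
  then show ?thesis unfolding s_def by (rule LIM_zero_cancel)
qed

theorem theorem2:
  fixes C J :: "real^'n^'n" and D :: "real^'m^'n" and p :: "real^'m"
    and v :: "real^'n" and \<beta> :: real and X :: "nat \<Rightarrow> real^'n"
  assumes "\<And>i l. 0 \<le> C $ i $ l \<and> C $ i $ l \<le> 1"
    and "\<And>i. C $ i $ i = 0"
    and "\<And>i. 0 < Chat C $ i $ i"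
    and "0 \<le> \<beta>"
    and "sign_matrix J"
    and "X 0 \<in> positive_orthant"
    and "\<And>t. X (Suc t) = A_mat C J *v X t + b_vec C D p v \<beta> J (X t)"
    and "\<And>i. i \<in> neg_indices J \<Longrightarrow>
      (D *v p) $ i \<le> ((matrix_inv (Chat C) - C ** matrix_inv (Chat C)) *v v) $ i + \<beta>"
    and "\<And>i. i \<in> pos_indices J \<Longrightarrow>
      (D *v p) $ i \<ge> ((matrix_inv (Chat C) - C ** matrix_inv (Chat C)) *v v) $ i"
    and "\<And>i l. J $ i $ i \<noteq> J $ l $ l \<Longrightarrow> C $ i $ l = 0"
    and "\<And>i. 0 \<le> (\<Sum>l\<in>UNIV - {i}. Chat C $ i $ i * C $ i $ l * (1 / Chat C $ l $ l)) \<and>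
      (\<Sum>l\<in>UNIV - {i}. Chat C $ i $ i * C $ i $ l * (1 / Chat C $ l $ l)) < 1"
  shows "\<exists>Xs. X \<longlonglongrightarrow> Xs
    \<and> Xs \<in> positive_orthant \<and> equilibrium C D p v \<beta> J Xs
    \<and> (\<forall>Y \<in> positive_orthant. equilibrium C D p v \<beta> J Y \<longrightarrow> Y = Xs)
    \<and> invertible (mat 1 - J ** Chat C ** C ** matrix_inv (Chat C) ** J)
    \<and> Xs = matrix_inv (mat 1 - J ** Chat C ** C ** matrix_inv (Chat C) ** J) *v
        (J *v ((Chat C ** C ** matrix_inv (Chat C) - mat 1) *v v
               + Chat C *v (D *v p - failure_on J \<beta> (J *v Xs) - (\<beta> / 2) *\<^sub>R 1)))"
proof -
  note C0 = assms(1) and Cdiag = assms(2) and pos = assms(3) and J = assms(5)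
    and opp = assms(10) and rows = assms(11)
  have off: "Chat C $ i $ l = 0" if "i \<noteq> l" for i l
    using that by (simp add: Chat_def)
  have inv: "matrix_inv (Chat C) = (\<chi> i l. if i = l then 1 / Chat C $ i $ i else 0)"
    by (rule matrix_inv_diagonal) (use off pos in \<open>auto simp: less_imp_neq[symmetric]\<close>)
  have invoff: "matrix_inv (Chat C) $ i $ l = 0" if "i \<noteq> l" for i l
    using that by (simp add: inv)
  have Joff: "J $ i $ l = 0" if "i \<noteq> l" for i l
    using J that by (simp add: sign_matrix_def)
  have Jpm: "J $ i $ i = 1 \<or> J $ i $ i = -1" for i
    using J by (auto simp: sign_matrix_def)
  \<comment> \<open>Both copies of \<open>J\<close> disappear: equal signs multiply to
    \<open>1\<close>, and for opposite signs the entry of \<open>C\<close> vanishes.\<close>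
  have A_nth: "A_mat C J $ i $ l = Chat C $ i $ i * C $ i $ l * (1 / Chat C $ l $ l)" for i l
  proof -
    have "A_mat C J $ i $ l =
        J $ i $ i * Chat C $ i $ i * C $ i $ l * (1 / Chat C $ l $ l) * J $ l $ l"
      \<comment> \<open>The left-nested product gives up its diagonal factors on the right first;
        reassociating then exposes those on the left.\<close>
      by (simp only: A_mat_def diagonal_matrix_mult_right_nth[OF Joff]
          diagonal_matrix_mult_right_nth[OF invoff] not_False_eq_True)
        (simp add: diagonal_matrix_mult_left_nth[OF Joff] diagonal_matrix_mult_left_nth[OF off]
          inv flip: matrix_mul_assoc)
    then show ?thesis using opp[of i l] Jpm[of i] Jpm[of l] by auto
  qed
  have A_nonneg: "0 \<le> A_mat C J $ i $ l" for i l
    using C0 pos by (simp add: A_nth less_imp_le)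
  have A_rows: "(\<Sum>l\<in>UNIV. \<bar>A_mat C J $ i $ l\<bar>) < 1" for i
  proof -
    have "(\<Sum>l\<in>UNIV. \<bar>A_mat C J $ i $ l\<bar>) = (\<Sum>l\<in>UNIV. A_mat C J $ i $ l)"
      by (simp add: A_nonneg)
    also have "\<dots> = (\<Sum>l\<in>UNIV - {i}. A_mat C J $ i $ l)"
      by (rule sum.mono_neutral_right) (auto simp: A_nth Cdiag)
    finally have "(\<Sum>l\<in>UNIV. \<bar>A_mat C J $ i $ l\<bar>) = (\<Sum>l\<in>UNIV - {i}. A_mat C J $ i $ l)" .
    then show ?thesis using rows[of i] by (simp add: A_nth)
  qed

  \<comment> \<open>The origin lies in the positive orthant and so can represent the constant value
    of \<open>b_vec\<close> there.\<close>
  define b where "b = b_vec C D p v \<beta> J 0"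
  have b_const: "b_vec C D p v \<beta> J Y = b" if "Y \<in> positive_orthant" for Y
  proof -
    \<comment> \<open>Where \<open>J $ i $ i = -1\<close>, the entry of \<open>J *v Y\<close> is
      negative or zero, and \<open>failure_on\<close> treats both alike; the plain
      \<open>failure\<close> would jump at zero.\<close>
    have "failure_on J \<beta> (J *v Y) = failure_on J \<beta> (J *v 0)"
    proof (intro vec_eq_iff[THEN iffD2] allI)
      fix i
      have "0 \<le> Y $ i" using that by (simp add: mem_positive_orthant_iff)
      then show "failure_on J \<beta> (J *v Y) $ i = failure_on J \<beta> (J *v 0) $ i"
        using Jpm[of i] by (auto simp: failure_on_def sign_matrix_mult_nth[OF J])
    qed
    then show ?thesis by (simp add: b_def b_vec_def)
  qed
  define w where "w = (matrix_inv (Chat C) - C ** matrix_inv (Chat C)) *v v"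
  \<comment> \<open>Factoring \<open>Chat C\<close> out on the left leaves the threshold
    \<open>w\<close> of the two bounds on \<open>D *v p\<close>.\<close>
  have w: "(Chat C ** C ** matrix_inv (Chat C) - mat 1) *v v = - (Chat C *v w)"
  proof -
    have "Chat C ** matrix_inv (Chat C) = mat 1"
      using pos by (simp add: vec_eq_iff mat_def inv diagonal_matrix_mult_left_nth[OF off]
          less_imp_neq[symmetric])
    then show ?thesis
      by (simp add: w_def matrix_vector_mult_diff_rdistrib matrix_vector_mult_diff_distrib
          matrix_vector_mul_assoc matrix_mul_assoc)
  qed
  \<comment> \<open>The failure term and the shift by \<open>\<beta> / 2\<close> cancel for positive
    sign and add up to \<open>\<beta>\<close> for negative sign. The remaining bracket is the slack
    in the bound on \<open>D *v p\<close>, and the outer sign makes the product nonnegative in both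
    cases.\<close>
  have b_nth: "b $ i = J $ i $ i * (Chat C $ i $ i
      * ((D *v p) $ i - w $ i - (if J $ i $ i = -1 then \<beta> else 0)))" for i
    using Jpm[of i] unfolding b_def b_vec_def w
    by (auto simp: sign_matrix_mult_nth[OF J]
        diagonal_matrix_vector_mult_nth[OF off] failure_on_def algebra_simps)
  have b_nonneg: "0 \<le> b $ i" for i
    using Jpm[of i]
  proof
    assume 1: "J $ i $ i = 1"
    then have "w $ i \<le> (D *v p) $ i"
      using assms(9)[of i] by (simp add: pos_indices_def w_def)
    then show ?thesis using 1 pos[of i] by (simp add: b_nth)
  next
    assume 1: "J $ i $ i = -1"
    then have "(D *v p) $ i \<le> w $ i + \<beta>"
      using assms(8)[of i] by (simp add: neg_indices_def w_def)
    then show ?thesis using 1 pos[of i] by (simp add: b_nth mult_le_0_iff)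
  qed

  have X_nonneg: "X t \<in> positive_orthant" for t
  proof (induction t)
    case (Suc t)
    then have "0 \<le> (A_mat C J *v X t) $ i" for i
      using A_nonneg by (auto simp: mem_positive_orthant_iff matrix_vector_mult_def intro!: sum_nonneg)
    then show ?case
      using b_nonneg by (simp add: mem_positive_orthant_iff assms(7) b_const[OF Suc])
  qed (rule assms(6))
  define Xs where "Xs = matrix_inv (mat 1 - A_mat C J) *v b"
  have lim: "X \<longlonglongrightarrow> Xs"
    unfolding Xs_def
    by (rule affine_iteration_converges[OF A_rows]) (simp add: assms(7) b_const[OF X_nonneg])
  have Xs_pos: "Xs \<in> positive_orthant"
    unfolding mem_positive_orthant_iff
  proof
    fix i
    have "(\<lambda>t. X t $ i) \<longlonglongrightarrow> Xs $ i" using lim by (rule tendsto_vec_nth)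
    then show "0 \<le> Xs $ i"
      by (rule LIMSEQ_le_const) (use X_nonneg in \<open>auto simp: mem_positive_orthant_iff\<close>)
  qed
  have invIA: "invertible (mat 1 - A_mat C J)"
    by (rule invertible_one_minus_contraction[OF A_rows])
  \<comment> \<open>With \<open>b_vec\<close> constant on the orthant, the equilibrium condition is
    a linear system with invertible matrix, which yields both existence and uniqueness.\<close>
  have eq_iff: "equilibrium C D p v \<beta> J Y \<longleftrightarrow> Y = Xs" if "Y \<in> positive_orthant" for Y
  proof -
    have "equilibrium C D p v \<beta> J Y \<longleftrightarrow> (mat 1 - A_mat C J) *v Y = b"
      by (auto simp: equilibrium_def b_const[OF that] matrix_vector_mult_diff_rdistrib algebra_simps)
    also have "\<dots> \<longleftrightarrow> Y = Xs"
      unfolding Xs_def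
      using matrix_inv_left[OF invIA] matrix_inv_right[OF invIA]
      by (metis matrix_vector_mul_assoc matrix_vector_mul_lid)
    finally show ?thesis .
  qed
  \<comment> \<open>The claimed formula is implicit, with \<open>Xs\<close> also inside the failure
    term; constancy of \<open>b_vec\<close> turns the explicit definition into it.\<close>
  have "Xs = matrix_inv (mat 1 - A_mat C J) *v b_vec C D p v \<beta> J Xs"
    unfolding b_const[OF Xs_pos] by (rule Xs_def)
  then show ?thesis
    using lim Xs_pos eq_iff invIA unfolding A_mat_def b_vec_def by blast
qed

end
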